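(* Let $\nu$ and $\nu'$ be s-finite measures on a measurable space $X$. Suppose that $\nu'=\nu\triangleright f$ for a measurable $f:X\to[0,\infty]$, and let $g:X\to[0,\infty]$ be measurable. Then $\nu'=\nu\triangleright g$ if and only if $$\nu\big(\{f\neq g\}\cap (X\setminus\infty[\nu])\big)+\nu\big(\{g=0\neq f\}\cap\infty[\nu]\big)+\nu\big(\{f=0\neq g\}\cap\infty[\nu]\big)=0 .$$
   Context: A measure is s-finite if it is a countable sum of finite measures. For a measure $\nu$ on $X$ and measurable $f:X\to[0,\infty]$, $(\nu\triangleright f)(V):=\int_V \nu(\mathrm{d}x)\,f(x)$. Convention: $\infty\cdot0=0$. A set $U\in\Sigma_X$ is a $\nu$-$0$-$\infty$-set if every measurable $V\subseteq U$ satisfies $\nu(V)\in\{0,\infty\}$. A top $0$-$\infty$-set for $\nu$ is a $\nu$-$0$-$\infty$-set $A$ such that $\nu(B\setminus A)=0$ for every $\nu$-$0$-$\infty$-set $B$; every s-finite measure has one, it is unique up to $\nu$-null sets, and $\infty[\nu]$ denotes a choice of it. *)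

theory Defs
  imports "HOL-Analysis.Analysis"
begin

text \<open>
  Every summand is a measure on the same \<open>\<sigma>\<close>-algebra as \<open>\<nu>\<close>. Finite sums are included, since
  summands may be zero.
\<close>

definition s_finite_measure :: "'a measure \<Rightarrow> bool" where
  "s_finite_measure \<nu> \<longleftrightarrow>
     (\<exists>N :: nat \<Rightarrow> 'a measure.
        (\<forall>i. finite_measure (N i) \<and> sets (N i) = sets \<nu>) \<and>
        (\<forall>V\<in>sets \<nu>. emeasure \<nu> V = (\<Sum>i. emeasure (N i) V)))"

definition zero_infty_set :: "'a measure \<Rightarrow> 'a set \<Rightarrow> bool" where
  "zero_infty_set \<nu> U \<longleftrightarrow>
     U \<in> sets \<nu> \<and> (\<forall>V\<in>sets \<nu>. V \<subseteq> U \<longrightarrow> emeasure \<nu> V \<in> {0, \<infinity>})"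

definition top_zero_infty_set :: "'a measure \<Rightarrow> 'a set \<Rightarrow> bool" where
  "top_zero_infty_set \<nu> A \<longleftrightarrow>
     zero_infty_set \<nu> A \<and> (\<forall>B. zero_infty_set \<nu> B \<longrightarrow> emeasure \<nu> (B - A) = 0)"

text \<open>
  A top set is unique only up to null sets, so results about it are stated for an arbitrary
  set satisfying \<^const>\<open>top_zero_infty_set\<close>. The lemma \<open>top_zero_infty_set_exists\<close> below shows
  that such statements are not vacuous for s-finite measures.
\<close>

lemma zero_infty_set_UN:
  fixes A :: "nat \<Rightarrow> 'a set"
  assumes A: "\<And>i. zero_infty_set \<nu> (A i)"
  shows "zero_infty_set \<nu> (\<Union>i. A i)"
  unfolding zero_infty_set_def
proof (intro conjI ballI impI)
  have m: "A i \<in> sets \<nu>" for i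
    using A by (simp add: zero_infty_set_def)
  then show "(\<Union>i. A i) \<in> sets \<nu>" by auto
  fix V assume V: "V \<in> sets \<nu>" "V \<subseteq> (\<Union>i. A i)"
  have VA: "V \<inter> A i \<in> sets \<nu>" for i
    using V(1) m by auto
  have zi: "emeasure \<nu> (V \<inter> A i) \<in> {0, \<infinity>}" for i
    using A[of i] VA[of i] unfolding zero_infty_set_def by blast
  show "emeasure \<nu> V \<in> {0, \<infinity>}"
  proof (cases "\<forall>i. emeasure \<nu> (V \<inter> A i) = 0")
    case True
    then have "emeasure \<nu> (\<Union>i. V \<inter> A i) = 0"
      using VA by (intro emeasure_UN_eq_0) auto
    moreover have "(\<Union>i. V \<inter> A i) = V" using V(2) by auto
    ultimately show ?thesis by simp
  next
    case False
    then obtain i where "emeasure \<nu> (V \<inter> A i) = \<infinity>" using zi by blast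
    moreover have "emeasure \<nu> (V \<inter> A i) \<le> emeasure \<nu> V"
      using V by (intro emeasure_mono) auto
    ultimately show ?thesis by (simp add: top_unique)
  qed
qed

lemma zero_infty_set_Un:
  assumes "zero_infty_set \<nu> A" "zero_infty_set \<nu> B"
  shows "zero_infty_set \<nu> (A \<union> B)"
proof -
  have "zero_infty_set \<nu> (\<Union>i::nat. if i = 0 then A else B)"
    using assms by (intro zero_infty_set_UN) auto
  moreover have "(\<Union>i::nat. if i = 0 then A else B) = A \<union> B"
    by (auto split: if_splits intro: exI[of _ "1::nat"])
  ultimately show ?thesis by simp
qed

lemma top_zero_infty_set_exists:
  assumes "s_finite_measure \<nu>"
  shows "\<exists>A. top_zero_infty_set \<nu> A"
proof -
  obtain N :: "nat \<Rightarrow> 'a measure" where fin: "\<And>i. finite_measure (N i)"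
    and sN: "\<And>i. sets (N i) = sets \<nu>"
    and eN: "\<And>V. V \<in> sets \<nu> \<Longrightarrow> emeasure \<nu> V = (\<Sum>i. emeasure (N i) V)"
    using assms unfolding s_finite_measure_def by blast
  let ?Z = "{B. zero_infty_set \<nu> B}"
  have "\<exists>A. zero_infty_set \<nu> A \<and>
      (\<forall>B. zero_infty_set \<nu> B \<longrightarrow> emeasure (N i) B \<le> emeasure (N i) A)" for i
  proof -
    have "{} \<in> ?Z" by (auto simp: zero_infty_set_def)
    then have "emeasure (N i) ` ?Z \<noteq> {}" by blast
    then obtain a :: "nat \<Rightarrow> ennreal" where a: "range a \<subseteq> emeasure (N i) ` ?Z"
      "Sup (emeasure (N i) ` ?Z) = Sup (range a)"
      using ennreal_Sup_countable_SUP[of "emeasure (N i) ` ?Z"] by metis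
    have "\<forall>n. \<exists>C. zero_infty_set \<nu> C \<and> emeasure (N i) C = a n"
      using a(1) by (auto simp: image_subset_iff image_iff Bex_def) metis
    then obtain C where C: "\<And>n. zero_infty_set \<nu> (C n)" "\<And>n. emeasure (N i) (C n) = a n"
      by metis
    have Cm: "C n \<in> sets (N i)" for n
      using C(1) sN by (simp add: zero_infty_set_def)
    have "a n \<le> emeasure (N i) (\<Union>n. C n)" for n
      unfolding C(2)[symmetric] using Cm by (intro emeasure_mono) auto
    then have "Sup (range a) \<le> emeasure (N i) (\<Union>n. C n)"
      by (auto intro: SUP_least)
    moreover have "emeasure (N i) B \<le> Sup (range a)" if "zero_infty_set \<nu> B" for B
      unfolding a(2)[symmetric] using that by (intro Sup_upper) auto
    ultimately show ?thesis
      using zero_infty_set_UN[of \<nu> C, OF C(1)] by (meson order_trans)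
  qed
  then obtain A where A: "\<And>i. zero_infty_set \<nu> (A i)"
    "\<And>i B. zero_infty_set \<nu> B \<Longrightarrow> emeasure (N i) B \<le> emeasure (N i) (A i)"
    by metis
  have "emeasure \<nu> (B - (\<Union>i. A i)) = 0" if B: "zero_infty_set \<nu> B" for B
  proof -
    have m: "A i \<in> sets \<nu>" "B \<in> sets \<nu>" for i
      using A(1) B by (auto simp: zero_infty_set_def)
    have "emeasure (N i) (B - (\<Union>i. A i)) = 0" for i
    proof -
      interpret finite_measure "N i" by (rule fin)
      have "emeasure (N i) (A i) + emeasure (N i) (B - A i) = emeasure (N i) (A i \<union> (B - A i))"
        using m sN by (intro plus_emeasure) auto
      also have "A i \<union> (B - A i) = A i \<union> B" by auto
      also have "emeasure (N i) (A i \<union> B) \<le> emeasure (N i) (A i) + 0"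
        using A(2)[OF zero_infty_set_Un[OF A(1) B]] by simp
      finally have "emeasure (N i) (B - A i) = 0"
        by (subst (asm) ennreal_add_left_cancel_le) (auto simp: emeasure_eq_measure)
      moreover have "emeasure (N i) (B - (\<Union>i. A i)) \<le> emeasure (N i) (B - A i)"
        using m sN by (intro emeasure_mono) auto
      ultimately show ?thesis by simp
    qed
    then show ?thesis using m by (subst eN) auto
  qed
  then show ?thesis
    using zero_infty_set_UN[of \<nu> A, OF A(1)] unfolding top_zero_infty_set_def by blast
qed

end

theory Submission
  imports Defs
begin

text \<open>
  If \<open>f\<close> and \<open>g\<close> are densities of the same measure, uniqueness of densities over finite
  measures shows that every subset of \<open>{f \<noteq> g}\<close> of finite measure is null. So \<open>{f \<noteq> g}\<close>
  is itself a 0-\<open>\<infinity>\<close>-set, and \<open>{f \<noteq> g} - A\<close> is null by maximality of \<open>A\<close>. On \<open>A\<close>,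
  integration against \<open>\<nu>\<close> only sees where the integrand vanishes.
\<close>

lemma zero_infty_set_subset:
  assumes "zero_infty_set M U" "V \<in> sets M" "V \<subseteq> U"
  shows "zero_infty_set M V"
  using assms unfolding zero_infty_set_def by blast

text \<open>If the integral is finite, Markov's inequality gives finite measure to each set where
  \<open>f\<close> is at least \<open>1/n\<close>. Inside a 0-infinity set such sets are null, and
  they exhaust the support of \<open>f\<close>. So the integral depends on \<open>f\<close> only
  through the measure of its support.\<close>

lemma nn_integral_zero_infty_set:
  assumes U: "zero_infty_set M U" and f[measurable]: "f \<in> borel_measurable M"
  shows "(\<integral>\<^sup>+x\<in>U. f x \<partial>M) = \<infinity> * emeasure M {x \<in> U. f x \<noteq> 0}"
proof -
  have [measurable]: "U \<in> sets M"
    using U by (simp add: zero_infty_set_def)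
  have space: "x \<in> space M" if "x \<in> U" for x
    using that \<open>U \<in> sets M\<close> sets.sets_into_space by blast
  have S: "{x \<in> U. P (f x)} = {x \<in> space M. x \<in> U \<and> P (f x)}" for P
    using space by blast
  have dichotomy: "emeasure M V = 0 \<or> emeasure M V = \<infinity>" if "V \<in> sets M" "V \<subseteq> U" for V
    using U that by (simp add: zero_infty_set_def)
  have meas: "{x \<in> U. f x \<noteq> 0} \<in> sets M"
    unfolding S by measurable
  have "emeasure M {x \<in> U. f x \<noteq> 0} = 0 \<or> emeasure M {x \<in> U. f x \<noteq> 0} = \<infinity>"
    using meas by (intro dichotomy) auto
  moreover have "(\<integral>\<^sup>+x\<in>U. f x \<partial>M) = 0 \<longleftrightarrow> emeasure M {x \<in> U. f x \<noteq> 0} = 0"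
  proof -
    have "{x \<in> space M. f x * indicator U x \<noteq> 0} = {x \<in> U. f x \<noteq> 0}"
      using space by (auto simp: indicator_def)
    then show ?thesis by (subst nn_integral_0_iff) auto
  qed
  moreover have "emeasure M {x \<in> U. f x \<noteq> 0} = 0" if fin: "(\<integral>\<^sup>+x\<in>U. f x \<partial>M) \<noteq> \<infinity>"
  proof -
    \<comment> \<open>The threshold \<open>1/n\<close> is written multiplicatively to avoid division
      in \<open>ennreal\<close>; for \<open>n = 0\<close> the set is empty.\<close>
    have L: "emeasure M {x \<in> U. 1 \<le> of_nat n * f x} = 0" for n
    proof -
      have "{x \<in> U. 1 \<le> of_nat n * f x} \<in> sets M"
        unfolding S by measurable
      moreover have "emeasure M {x \<in> U. 1 \<le> of_nat n * f x} \<le> of_nat n * (\<integral>\<^sup>+x\<in>U. f x \<partial>M)"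
        using nn_integral_Markov_inequality[of f U M "of_nat n"] by simp
      then have "emeasure M {x \<in> U. 1 \<le> of_nat n * f x} < \<infinity>"
        by (rule le_less_trans) (use fin in \<open>simp add: ennreal_mult_eq_top_iff less_top[symmetric]\<close>)
      ultimately show ?thesis
        using dichotomy[of "{x \<in> U. 1 \<le> of_nat n * f x}"] by auto
    qed
    have "{x \<in> U. f x \<noteq> 0} = (\<Union>n. {x \<in> U. 1 \<le> of_nat n * f x})"
    proof -
      have "\<exists>n. 1 \<le> of_nat n * f x" if "f x \<noteq> 0" for x
      proof (cases "f x = \<infinity>")
        case True
        then show ?thesis by (intro exI[of _ 1]) auto
      next
        case False
        then obtain r where r: "f x = ennreal r" "0 \<le> r"
          by (cases "f x") auto
        with that have "0 < r" by auto
        then obtain n where "1 < real n * r"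
          using reals_Archimedean3 by blast
        then have "ennreal 1 \<le> ennreal (real n) * f x"
          unfolding r(1) using r(2) by (subst ennreal_mult[symmetric]) (auto intro!: ennreal_leI)
        then show ?thesis
          by (auto simp: ennreal_of_nat_eq_real_of_nat)
      qed
      then show ?thesis by fastforce
    qed
    moreover have "{x \<in> U. 1 \<le> of_nat n * f x} \<in> sets M" for n
      unfolding S by measurable
    ultimately show ?thesis
      by (simp only:, intro emeasure_UN_eq_0 L) blast
  qed
  \<comment> \<open>A finite integral has a null support and is therefore 0. An infinite one has a
    non-null support, which then has infinite measure by the dichotomy.\<close>
  ultimately show ?thesis
    by (cases "(\<integral>\<^sup>+x\<in>U. f x \<partial>M) = \<infinity>") (auto simp: ennreal_top_mult)
qed

lemma density_eq_imp_zero_infty_set: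
  assumes f[measurable]: "f \<in> borel_measurable M" and g[measurable]: "g \<in> borel_measurable M"
    and eq: "density M f = density M g"
  shows "zero_infty_set M {x \<in> space M. f x \<noteq> g x}"
  unfolding zero_infty_set_def
proof (intro conjI ballI impI)
  show "{x \<in> space M. f x \<noteq> g x} \<in> sets M" by measurable
  fix V assume V[measurable]: "V \<in> sets M" and sub: "V \<subseteq> {x \<in> space M. f x \<noteq> g x}"
  have "emeasure M V = 0" if "emeasure M V \<noteq> \<infinity>"
  proof -
    \<comment> \<open>This is \<open>M\<close> restricted to \<open>V\<close>. Writing the
      restriction as a density lets it commute with \<open>density M h\<close>, so \<open>eq\<close>
      passes to \<open>?N\<close>.\<close>
    let ?N = "density M (indicator V)"
    interpret finite_measure ?N
      using that by (intro finite_measureI) (simp add: emeasure_density cong: nn_integral_cong)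
    have "density ?N h = density (density M h) (indicator V)" if "h \<in> borel_measurable M" for h
      using that by (simp add: density_density_eq mult.commute)
    then have "density ?N f = density ?N g"
      using eq by simp
    then have "AE x in ?N. f x = g x"
      by (intro density_unique) auto
    then have "AE x in M. 0 < (indicator V x :: ennreal) \<longrightarrow> f x = g x"
      by (subst (asm) AE_density) auto
    \<comment> \<open>The functions differ everywhere on \<open>V\<close>, so almost everywhere
      equality on \<open>V\<close> can only mean that \<open>V\<close> is null.\<close>
    then have "AE x in M. x \<notin> V"
      by eventually_elim (use sub in auto)
    then show ?thesis
      using AE_iff_null_sets[OF V] by (simp add: null_setsD1)
  qed
  then show "emeasure M V \<in> {0, \<infinity>}" by blast
qed

text \<open>The set where \<open>g\<close> vanishes is null for \<open>density M g\<close>, hence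
  for \<open>density M f\<close>; a nonzero \<open>f\<close> has zero integral only over a null set.
  No finiteness of \<open>M\<close> enters, so this also applies inside \<open>A\<close>, where
  densities need not be unique.\<close>

lemma density_eq_imp_null:
  assumes f[measurable]: "f \<in> borel_measurable M" and g[measurable]: "g \<in> borel_measurable M"
    and eq: "density M f = density M g"
  shows "emeasure M {x \<in> space M. g x = 0 \<and> f x \<noteq> 0} = 0"
proof -
  let ?B = "{x \<in> space M. g x = 0 \<and> f x \<noteq> 0}"
  have B: "?B \<in> sets M" by measurable
  have "emeasure (density M g) ?B = 0"
    by (subst emeasure_density[OF g B], subst nn_integral_0_iff_AE) (auto simp: indicator_def)
  then have "emeasure (density M f) ?B = 0"
    by (simp add: eq)
  then have "AE x in M. f x * indicator ?B x = 0"
    by (simp add: emeasure_density B nn_integral_0_iff_AE)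
  then have "AE x in M. \<not> (g x = 0 \<and> f x \<noteq> 0)"
    using AE_space by eventually_elim (auto simp: indicator_def)
  then show ?thesis
    by (rule emeasure_eq_0_AE)
qed

theorem theorem9:
  fixes X \<nu> \<nu>' :: "'a measure" and f g :: "'a \<Rightarrow> ennreal" and A :: "'a set"
  assumes "sets \<nu> = sets X" and "sets \<nu>' = sets X"
    and "s_finite_measure \<nu>" and "s_finite_measure \<nu>'"
    and "f \<in> borel_measurable X" and "g \<in> borel_measurable X"
    and "\<nu>' = density \<nu> f"
    and "top_zero_infty_set \<nu> A"
  shows "\<nu>' = density \<nu> g \<longleftrightarrow>
      emeasure \<nu> ({x \<in> space X. f x \<noteq> g x} \<inter> (space X - A))
    + emeasure \<nu> ({x \<in> space X. g x = 0 \<and> f x \<noteq> 0} \<inter> A)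
    + emeasure \<nu> ({x \<in> space X. f x = 0 \<and> g x \<noteq> 0} \<inter> A) = 0"
    (is "_ \<longleftrightarrow> emeasure \<nu> ?D + emeasure \<nu> ?G + emeasure \<nu> ?F = 0")
proof -
  have f[measurable]: "f \<in> borel_measurable \<nu>" and g[measurable]: "g \<in> borel_measurable \<nu>"
    using assms(5,6) measurable_cong_sets[OF assms(1) refl] by auto
  have sp: "space X = space \<nu>"
    using sets_eq_imp_space_eq[OF assms(1)] by simp
  have A: "zero_infty_set \<nu> A" and top: "\<And>B. zero_infty_set \<nu> B \<Longrightarrow> emeasure \<nu> (B - A) = 0"
    using assms(8) by (auto simp: top_zero_infty_set_def)
  then have Am[measurable]: "A \<in> sets \<nu>"
    by (simp add: zero_infty_set_def)
  have meas: "?D \<in> sets \<nu>" "?G \<in> sets \<nu>" "?F \<in> sets \<nu>"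
    unfolding sp by measurable
  show ?thesis
  proof
    assume "\<nu>' = density \<nu> g"
    then have eq: "density \<nu> f = density \<nu> g"
      using assms(7) by simp
    have "?D = {x \<in> space \<nu>. f x \<noteq> g x} - A"
      by (auto simp: sp)
    then have "emeasure \<nu> ?D = 0"
      using top[OF density_eq_imp_zero_infty_set[OF f g eq]] by simp
    moreover have "emeasure \<nu> ?G = 0"
      using density_eq_imp_null[OF f g eq] unfolding sp
      by (rule emeasure_eq_0[rotated 1]) auto
    moreover have "emeasure \<nu> ?F = 0"
      using density_eq_imp_null[OF g f eq[symmetric]] unfolding sp
      by (rule emeasure_eq_0[rotated 1]) auto
    ultimately show "emeasure \<nu> ?D + emeasure \<nu> ?G + emeasure \<nu> ?F = 0" by simp
  next
    assume "emeasure \<nu> ?D + emeasure \<nu> ?G + emeasure \<nu> ?F = 0"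
    then have "?D \<in> null_sets \<nu>" "?G \<in> null_sets \<nu>" "?F \<in> null_sets \<nu>"
      using meas by (auto simp: null_sets_def)
    then have D: "AE x in \<nu>. x \<notin> ?D" and G: "AE x in \<nu>. x \<notin> ?G" and F: "AE x in \<nu>. x \<notin> ?F"
      by (simp_all only: AE_not_in)
    have "density \<nu> f = density \<nu> g"
    proof (rule measure_eqI)
      fix V assume "V \<in> sets (density \<nu> f)"
      then have V[measurable]: "V \<in> sets \<nu>" by simp
      \<comment> \<open>The two pieces agree for different reasons: off \<open>A\<close> the
        integrands coincide almost everywhere, while on \<open>A\<close> only their supports
        count.\<close>
      have split: "emeasure (density \<nu> h) V = (\<integral>\<^sup>+x\<in>V - A. h x \<partial>\<nu>) + (\<integral>\<^sup>+x\<in>V \<inter> A. h x \<partial>\<nu>)"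
        if [measurable]: "h \<in> borel_measurable \<nu>" for h
        by (subst nn_integral_add[symmetric])
          (auto simp: emeasure_density indicator_def intro!: nn_integral_cong)
      have "(\<integral>\<^sup>+x\<in>V - A. f x \<partial>\<nu>) = (\<integral>\<^sup>+x\<in>V - A. g x \<partial>\<nu>)"
        using D AE_space
        by (intro nn_integral_cong_AE, eventually_elim) (auto simp: sp indicator_def)
      \<comment> \<open>Outside \<open>?G\<close> and \<open>?F\<close>, the functions
        \<open>f\<close> and \<open>g\<close> vanish at the same points of \<open>A\<close>.\<close>
      moreover have "emeasure \<nu> {x \<in> V \<inter> A. f x \<noteq> 0} = emeasure \<nu> {x \<in> V \<inter> A. g x \<noteq> 0}"
      proof (rule emeasure_eq_AE)
        show "AE x in \<nu>. x \<in> {x \<in> V \<inter> A. f x \<noteq> 0} \<longleftrightarrow> x \<in> {x \<in> V \<inter> A. g x \<noteq> 0}"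
          using G F AE_space by eventually_elim (auto simp: sp)
        have "{x \<in> V \<inter> A. h x \<noteq> 0} = {x \<in> space \<nu>. x \<in> V \<inter> A \<and> h x \<noteq> 0}" for h :: "'a \<Rightarrow> ennreal"
          using sets.sets_into_space[OF V] by blast
        then show "{x \<in> V \<inter> A. f x \<noteq> 0} \<in> sets \<nu>" "{x \<in> V \<inter> A. g x \<noteq> 0} \<in> sets \<nu>"
          by simp_all
      qed
      moreover have "zero_infty_set \<nu> (V \<inter> A)"
        using A by (rule zero_infty_set_subset) auto
      ultimately show "emeasure (density \<nu> f) V = emeasure (density \<nu> g) V"
        by (simp add: split nn_integral_zero_infty_set)
    qed simp
    then show "\<nu>' = density \<nu> g"
      using assms(7) by simp
  qed
qed

end
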